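(* Let $G\in\mathbb{R}^{n\times n}$ be symmetric with eigendecomposition $G=V\Lambda V^\top$, $\Lambda=\mathrm{diag}(\lambda_1,\dots,\lambda_n)$, and for $h>0$ let $H(G,h)=\int_0^h e^{-G\tau}\,d\tau$. Then $H(G,h)=V\,\mathrm{diag}\bigl(\eta_h(\lambda_i)\bigr)\,V^\top$ with $$\eta_h(\lambda)=\frac{1-e^{-h\lambda}}{\lambda}\quad(\lambda\ne0),\qquad\eta_h(0)=h,$$ and: (i) $\eta_h(\lambda)\to1/\lambda$ as $h\lambda\to\infty$ (Newton limit); (ii) $\eta_h(\lambda)=h\bigl(1-h\lambda/2+\mathcal{O}(h^2\lambda^2)\bigr)$ as $\lambda\to0$ (gradient limit); (iii) for $\lambda<0$, $\eta_h(\lambda)=(e^{h|\lambda|}-1)/|\lambda|$ grows exponentially in $h$ (saddle amplification); (iv) the doubling identity $H(G,2h)=H(G,h)\,\bigl(2I-G\,H(G,h)\bigr)$ holds, so a geometric horizon search costs one application per candidate; (v) for $G\succ0$ and $h\le0.1/\|G\|$, the step $x^+=x-H(G,h)\,g$ satisfies $f(x^+)<f(x)$ for the quadratic model (that is, with $f$ replaced by its local quadratic model at $x$), and the descent property transfers to $f$ under a standard Lipschitz–Hessian argument.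
   Context: $\|\cdot\|$ is the Euclidean norm (spectral norm for matrices). $f$ is the twice-differentiable objective; $g\neq0$ is its gradient at the current point $x$ and $G$ plays the role of its Hessian there (in the method, those of one parameter block). The local quadratic model at $x$ is $q(z)=f(x)+\langle g,z-x\rangle+\tfrac12\langle z-x,G(z-x)\rangle$, so model descent means $q(x^+)<q(x)$. $h$ is called the horizon: $-H(G,h)g$ is the displacement at time $h$ of the gradient flow of $q$ started at $x$. A geometric horizon search tries $h,2h,4h,\dots$ successively. Lipschitz–Hessian means: there is $L_H\ge0$ with $\|\nabla^2 f(y)-\nabla^2 f(z)\|\le L_H\|y-z\|$ for all $y,z$.
   Formalization: In (v), descent of f itself is claimed only for h below a threshold depending on G, g, L_H, or when L_H‖x⁺−x‖³/6 is less than the model decrease; for all h ≤ 0.1/‖G‖ it is false (n=1, f(y)=y+0.005y²−y³/6, x=0, h=10). *)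

theory Defs
  imports "HOL-Analysis.Analysis" "HOL-Library.Landau_Symbols"
begin

definition diag_matrix :: "real^'n \<Rightarrow> real^'n^'n" where
  "diag_matrix d = (\<chi> i j. if i = j then d $ i else 0)"

(* The generic exp is of no use here: the ring structure that the library puts on real^'n^'n
   is componentwise. The k-th power is therefore taken with respect to **. *)
definition matrix_exp :: "real^'n^'n \<Rightarrow> real^'n^'n" where
  "matrix_exp A = (\<Sum>k. (1 / fact k) *\<^sub>R (((**) A ^^ k) (mat 1)))"

definition horizon_matrix :: "real^'n^'n \<Rightarrow> real \<Rightarrow> real^'n^'n" where
  "horizon_matrix G h = integral {0..h} (\<lambda>\<tau>. matrix_exp (- (\<tau> *\<^sub>R G)))"

definition eta :: "real \<Rightarrow> real \<Rightarrow> real" where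
  "eta h l = (if l = 0 then h else (1 - exp (- h * l)) / l)"

(* The norm of the type real^'n^'n is the Frobenius norm; the spectral norm is the operator norm. *)
definition spectral_norm :: "real^'n^'n \<Rightarrow> real" where
  "spectral_norm A = onorm (\<lambda>v. A *v v)"

(* Symmetry is not part of this definition. *)
definition pos_def :: "real^'n^'n \<Rightarrow> bool" where
  "pos_def A \<longleftrightarrow> (\<forall>v. v \<noteq> 0 \<longrightarrow> 0 < v \<bullet> (A *v v))"

definition doubling_step :: "real^'n^'n \<Rightarrow> real^'n^'n \<Rightarrow> real^'n^'n" where
  "doubling_step G X = X ** (2 *\<^sub>R mat 1 - G ** X)"

definition quad_model ::
  "(real^'n \<Rightarrow> real) \<Rightarrow> real^'n \<Rightarrow> real^'n^'n \<Rightarrow> real^'n \<Rightarrow> real^'n \<Rightarrow> real" where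
  "quad_model f g G x z = f x + g \<bullet> (z - x) + 1/2 * ((z - x) \<bullet> (G *v (z - x)))"

definition horizon_step :: "real^'n^'n \<Rightarrow> real^'n \<Rightarrow> real \<Rightarrow> real^'n \<Rightarrow> real^'n" where
  "horizon_step G g h x = x - horizon_matrix G h *v g"

definition has_gradient_hessian ::
  "(real^'n \<Rightarrow> real) \<Rightarrow> (real^'n \<Rightarrow> real^'n) \<Rightarrow> (real^'n \<Rightarrow> real^'n^'n) \<Rightarrow> bool" where
  "has_gradient_hessian f gf Hf \<longleftrightarrow>
     (\<forall>y. GDERIV f y :> gf y) \<and> (\<forall>y. (gf has_derivative (\<lambda>v. Hf y *v v)) (at y))"

definition lipschitz_hessian :: "real \<Rightarrow> (real^'n \<Rightarrow> real^'n^'n) \<Rightarrow> bool" where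
  "lipschitz_hessian L Hf \<longleftrightarrow> (\<forall>y z. spectral_norm (Hf y - Hf z) \<le> L * norm (y - z))"

(* Filters on pairs (h, l) with h > 0, along which h * l tends to infinity (resp. to 0) with no
   other restriction on h and l. Limits along them are uniform in h. *)
definition product_at_top :: "(real \<times> real) filter" where
  "product_at_top = inf (filtercomap (\<lambda>(h, l). h * l) at_top) (principal {(h, l). 0 < h})"

definition product_to_0 :: "(real \<times> real) filter" where
  "product_to_0 = inf (filtercomap (\<lambda>(h, l). h * l) (nhds 0)) (principal {(h, l). 0 < h})"

end

theory Submission
  imports Defs
begin

text \<open>
  For orthogonal \<open>V\<close>, \<open>d \<mapsto> V diag(d) V\<^sup>T\<close> is a continuous
  homomorphism from the pointwise algebra of vectors to matrices, so the exponential series, its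
  integral and the doubling identity reduce to scalar facts about the eigenvalues. For the descent
  claims, \<open>\<lambda> \<eta>\<^sub>h(\<lambda>) < 1\<close> gives a model decrease of at least \<open>\<langle>g, H g\<rangle> / 2\<close>, whereas
  \<open>\<eta>\<^sub>h(\<lambda>) \<le> h\<close> bounds the cubic Taylor remainder by \<open>L h\<^sup>2 \<parallel>g\<parallel> \<langle>g, H g\<rangle> / 6\<close>; hence
  descent for \<open>f\<close> as soon as \<open>L h\<^sup>2 \<parallel>g\<parallel> < 3\<close>, a threshold that depends only on \<open>L\<close> and \<open>g\<close>.
\<close>

section \<open>Algebra of matrices diagonalised by one orthogonal matrix\<close>

definition conj_diag :: "real^'n^'n \<Rightarrow> real^'n \<Rightarrow> real^'n^'n" where
  "conj_diag V d = V ** diag_matrix d ** transpose V"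

lemma conj_diag_nth: "conj_diag V d $ i $ j = (\<Sum>k\<in>UNIV. d $ k * (V $ i $ k * V $ j $ k))"
proof -
  have "(V ** diag_matrix d) $ i $ k = V $ i $ k * d $ k" for k
    by (simp add: matrix_matrix_mult_def diag_matrix_def mult_delta_right)
  then show ?thesis
    unfolding conj_diag_def
    by (subst matrix_matrix_mult_def) (simp add: transpose_def mult_ac)
qed

lemma conj_diag_scaleR: "conj_diag V (c *\<^sub>R d) = c *\<^sub>R conj_diag V d"
  by (simp add: vec_eq_iff conj_diag_nth sum_distrib_left mult_ac)

lemma conj_diag_diff: "conj_diag V (d - e) = conj_diag V d - conj_diag V e"
  by (simp add: vec_eq_iff conj_diag_nth sum_subtractf algebra_simps)

text \<open>For orthogonal \<open>V\<close> the matrices \<open>conj_diag V (axis i 1)\<close> are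
  the projections onto the eigenlines. They do not depend on \<open>d\<close>, so a matrix series or
  integral becomes a finite sum of scalar ones with constant matrix coefficients.\<close>

lemma conj_diag_axis_expansion:
  "conj_diag V d = (\<Sum>i\<in>UNIV. d $ i *\<^sub>R conj_diag V (axis i 1))"
  by (simp add: vec_eq_iff conj_diag_nth axis_def mult_delta_left mult_delta_right)

lemma diag_matrix_mult: "diag_matrix d ** diag_matrix e = diag_matrix (d * e)"
  by (simp add: vec_eq_iff matrix_matrix_mult_def diag_matrix_def mult_delta_left mult_delta_right)

lemma diag_matrix_one: "diag_matrix 1 = mat 1"
  by (simp add: vec_eq_iff diag_matrix_def mat_def)

lemma conj_diag_mult:
  assumes "orthogonal_matrix V"
  shows "conj_diag V d ** conj_diag V e = conj_diag V (d * e)"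
proof -
  have "conj_diag V d ** conj_diag V e
      = V ** diag_matrix d ** (transpose V ** V) ** diag_matrix e ** transpose V"
    unfolding conj_diag_def by (simp add: matrix_mul_assoc)
  also have "\<dots> = V ** (diag_matrix d ** diag_matrix e) ** transpose V"
    using assms by (simp add: orthogonal_matrix_def matrix_mul_assoc)
  finally show ?thesis
    by (simp add: diag_matrix_mult conj_diag_def)
qed

lemma conj_diag_one: "orthogonal_matrix V \<Longrightarrow> conj_diag V 1 = mat 1"
  by (simp add: conj_diag_def diag_matrix_one orthogonal_matrix_def)

text \<open>In eigencoordinates the form is a weighted sum with weights \<open>d $ i\<close>; each
  later estimate on \<open>g\<close> thereby reduces to comparing weights of the squared
  coordinates.\<close>

lemma inner_conj_diag:
  "v \<bullet> (conj_diag V d *v w) = (\<Sum>i\<in>UNIV. d $ i * ((transpose V *v v) $ i * (transpose V *v w) $ i))"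
proof -
  have "v \<bullet> (conj_diag V d *v w) = (transpose V *v v) \<bullet> (diag_matrix d *v (transpose V *v w))"
    unfolding conj_diag_def
    by (metis dot_lmul_matrix matrix_vector_mul_assoc transpose_matrix_vector)
  also have "diag_matrix d *v (transpose V *v w) = d * (transpose V *v w)"
    by (simp add: vec_eq_iff matrix_vector_mult_def diag_matrix_def mult_delta_left)
  finally show ?thesis
    by (simp add: inner_vec_def mult_ac)
qed

lemma inner_conj_diag_conj_diag:
  assumes "orthogonal_matrix V"
  shows "(conj_diag V d *v v) \<bullet> (conj_diag V e *v w) = v \<bullet> (conj_diag V (d * e) *v w)"
proof -
  have "transpose (conj_diag V d) = conj_diag V d"
    by (simp add: vec_eq_iff transpose_def conj_diag_nth mult_ac)
  then have "(conj_diag V d *v v) \<bullet> (conj_diag V e *v w)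
      = v \<bullet> (conj_diag V d *v (conj_diag V e *v w))"
    by (metis dot_lmul_matrix transpose_matrix_vector)
  then show ?thesis
    by (simp add: matrix_vector_mul_assoc conj_diag_mult[OF assms])
qed

section \<open>Matrix exponential and its integral in the eigenbasis\<close>

lemma conj_diag_power:
  fixes V :: "real^'n^'n"
  assumes "orthogonal_matrix V"
  shows "((**) (conj_diag V d) ^^ k) (mat 1) = conj_diag V (\<chi> i. d $ i ^ k)"
proof (induction k)
  case 0
  have "(\<chi> i. d $ i ^ 0) = (1 :: real^'n)"
    by (simp add: vec_eq_iff)
  then show ?case
    using conj_diag_one[OF assms] by simp
next
  case (Suc k)
  have "d * (\<chi> i. d $ i ^ k) = (\<chi> i. d $ i ^ Suc k)"
    by (simp add: vec_eq_iff)
  with Suc show ?case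
    by (simp add: conj_diag_mult[OF assms])
qed

text \<open>Powers act on each eigenvalue separately, so the coefficient of each projection is the
  scalar exponential series.\<close>

lemma matrix_exp_conj_diag:
  assumes "orthogonal_matrix V"
  shows "matrix_exp (conj_diag V d) = conj_diag V (\<chi> i. exp (d $ i))"
proof -
  let ?E = "\<lambda>i. conj_diag V (axis i 1)"
  have "(1 / fact k) *\<^sub>R (((**) (conj_diag V d) ^^ k) (mat 1))
      = (\<Sum>i\<in>UNIV. (d $ i ^ k /\<^sub>R fact k) *\<^sub>R ?E i)" for k
    by (subst conj_diag_power[OF assms], subst conj_diag_axis_expansion)
       (simp add: scaleR_sum_right divide_inverse)
  moreover have "(\<lambda>k. \<Sum>i\<in>UNIV. (d $ i ^ k /\<^sub>R fact k) *\<^sub>R ?E i) sums (\<Sum>i\<in>UNIV. exp (d $ i) *\<^sub>R ?E i)"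
    by (intro sums_sum bounded_linear.sums[OF bounded_linear_scaleR_left] exp_converges)
  moreover have "(\<Sum>i\<in>UNIV. exp (d $ i) *\<^sub>R ?E i) = conj_diag V (\<chi> i. exp (d $ i))"
    by (subst (2) conj_diag_axis_expansion) simp
  ultimately show ?thesis
    unfolding matrix_exp_def by (simp add: sums_iff)
qed

text \<open>For \<open>l = 0\<close> the integrand is constantly 1 and the integral is the length
  \<open>h\<close>, which is the value \<open>eta\<close> has there; otherwise
  \<open>- exp (- (\<tau> * l)) / l\<close> is an antiderivative.\<close>

lemma has_integral_exp_eta:
  assumes "0 \<le> h"
  shows "((\<lambda>\<tau>. exp (- (\<tau> * l))) has_integral eta h l) {0..h}"
proof (cases "l = 0")
  case True
  then show ?thesis
    using has_integral_const_real[of "1::real" 0 h] assms by (simp add: eta_def)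
next
  case False
  have "((\<lambda>\<tau>. exp (- (\<tau> * l))) has_integral (- exp (- (h * l)) / l - (- exp (- (0 * l)) / l))) {0..h}"
  proof (rule fundamental_theorem_of_calculus[OF assms])
    fix t :: real
    show "((\<lambda>\<tau>. - exp (- (\<tau> * l)) / l) has_vector_derivative exp (- (t * l))) (at t within {0..h})"
      unfolding has_real_derivative_iff_has_vector_derivative[symmetric]
      by (auto intro!: derivative_eq_intros simp: False)
  qed
  then show ?thesis
    using False by (simp add: eta_def diff_divide_distrib)
qed

lemma horizon_matrix_conj_diag:
  assumes "orthogonal_matrix V" "0 \<le> h"
  shows "horizon_matrix (conj_diag V lam) h = conj_diag V (\<chi> i. eta h (lam $ i))"
proof -
  let ?E = "\<lambda>i. conj_diag V (axis i 1)"
  have "matrix_exp (- (\<tau> *\<^sub>R conj_diag V lam)) = (\<Sum>i\<in>UNIV. exp (- (\<tau> * lam $ i)) *\<^sub>R ?E i)" for \<tau>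
  proof -
    have "- (\<tau> *\<^sub>R conj_diag V lam) = conj_diag V ((- \<tau>) *\<^sub>R lam)"
      by (metis conj_diag_scaleR scaleR_minus_left)
    then show ?thesis
      by (simp only: matrix_exp_conj_diag[OF assms(1)])
         (subst conj_diag_axis_expansion, simp)
  qed
  moreover have "((\<lambda>\<tau>. \<Sum>i\<in>UNIV. exp (- (\<tau> * lam $ i)) *\<^sub>R ?E i) has_integral
      (\<Sum>i\<in>UNIV. eta h (lam $ i) *\<^sub>R ?E i)) {0..h}"
    by (intro has_integral_sum has_integral_scaleR_left has_integral_exp_eta assms) auto
  moreover have "(\<Sum>i\<in>UNIV. eta h (lam $ i) *\<^sub>R ?E i) = conj_diag V (\<chi> i. eta h (lam $ i))"
    by (subst (2) conj_diag_axis_expansion) simp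
  ultimately show ?thesis
    unfolding horizon_matrix_def by (simp add: integral_unique)
qed

section \<open>Limits, expansion and growth of the scalar function \<open>eta\<close>\<close>

lemma eta_tendsto_inverse:
  assumes "0 < l"
  shows "((\<lambda>h. eta h l) \<longlongrightarrow> 1 / l) at_top"
proof -
  have "LIM h at_top. l * h :> at_top"
    by (rule filterlim_tendsto_pos_mult_at_top[OF tendsto_const assms filterlim_ident])
  then have "((\<lambda>h. exp (- (l * h))) \<longlongrightarrow> 0) at_top"
    by (intro filterlim_compose[OF exp_at_bot] filterlim_compose[OF filterlim_uminus_at_bot_at_top])
  then have "((\<lambda>h. (1 - exp (- (l * h))) / l) \<longlongrightarrow> (1 - 0) / l) at_top"
    using assms by (intro tendsto_intros) auto
  then show ?thesis
    using assms by (simp add: eta_def mult.commute)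
qed

text \<open>The target \<open>1 / l\<close> itself varies along the filter, so the limit is stated
  for the ratio. That ratio is \<open>1 - exp (- (h * l))\<close>, a function of the product
  alone.\<close>

lemma eta_asymp_equiv_inverse: "(\<lambda>(h, l). eta h l) \<sim>[product_at_top] (\<lambda>(h, l). 1 / l)"
proof -
  have lim: "LIM p product_at_top. (case p of (h, l) \<Rightarrow> h * l) :> at_top"
    unfolding product_at_top_def by (rule filterlim_mono[OF filterlim_filtercomap order_refl inf_le1])
  have "((\<lambda>p. 1 - exp (- (case p of (h, l) \<Rightarrow> h * l))) \<longlongrightarrow> 1 - 0) product_at_top"
    by (intro tendsto_intros filterlim_compose[OF exp_at_bot]
        filterlim_compose[OF filterlim_uminus_at_bot_at_top] lim)
  \<comment> \<open>Eventually \<open>h * l > 0\<close>, which excludes \<open>l = 0\<close> and so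
    the exceptional branch of \<open>eta\<close>.\<close>
  moreover have "\<forall>\<^sub>F p in product_at_top. 1 - exp (- (case p of (h, l) \<Rightarrow> h * l))
      = (case p of (h, l) \<Rightarrow> eta h l) / (case p of (h, l) \<Rightarrow> 1 / l)"
    using filterlim_at_top_dense[THEN iffD1, OF lim, rule_format, of 0]
    by eventually_elim (auto simp: eta_def)
  ultimately have "((\<lambda>p. (case p of (h, l) \<Rightarrow> eta h l) / (case p of (h, l) \<Rightarrow> 1 / l)) \<longlongrightarrow> 1) product_at_top"
    by (auto elim: Lim_transform_eventually)
  then show ?thesis
    by (rule asymp_equivI')
qed

text \<open>The explicit constant 1, independent of \<open>h\<close> and \<open>l\<close>, yields
  both the expansion at a fixed horizon and the uniform one.\<close>

lemma eta_second_order: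
  assumes "0 < h" "\<bar>h * l\<bar> \<le> 1"
  shows "\<bar>eta h l / h - (1 - h * l / 2)\<bar> \<le> h\<^sup>2 * l\<^sup>2"
proof (cases "l = 0")
  case True
  with assms show ?thesis by (simp add: eta_def)
next
  case False
  define u where "u = h * l"
  have u: "u \<noteq> 0" "\<bar>u\<bar> \<le> 1"
    using False assms by (auto simp: u_def)
  \<comment> \<open>Three terms of the series are kept because dividing \<open>1 - exp (- u)\<close>
    by \<open>u\<close> loses one order: the cubic remainder turns into a quadratic one with factor
    \<open>exp t / 6\<close>, at most 1/2.\<close>
  obtain t where t: "\<bar>t\<bar> \<le> \<bar>- u\<bar>" "exp (- u) = (\<Sum>m<3. (- u) ^ m / fact m) + exp t / fact 3 * (- u) ^ 3"
    using Maclaurin_exp_le[of "- u" 3] by blast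
  have "t \<le> 1"
    using t(1) u(2) by linarith
  then have "exp t \<le> exp 1"
    by simp
  then have "exp t \<le> 3"
    using exp_le by linarith
  have "eta h l / h = (1 - exp (- u)) / u"
    using False assms by (simp add: eta_def u_def)
  also have "\<dots> = 1 - u / 2 + exp t / 6 * u\<^sup>2"
    using u by (simp add: t(2) eval_nat_numeral field_simps)
  finally have "\<bar>eta h l / h - (1 - u / 2)\<bar> = exp t / 6 * u\<^sup>2"
    by (simp add: abs_mult)
  also have "\<dots> \<le> 1 * u\<^sup>2"
    using \<open>exp t \<le> 3\<close> by (intro mult_right_mono) auto
  finally show ?thesis
    by (simp add: u_def power_mult_distrib)
qed

lemma eta_expansion_fixed_horizon:
  assumes "0 < h"
  shows "\<exists>r. (\<forall>l. eta h l = h * (1 - h * l / 2 + r l)) \<and> r \<in> O[nhds 0](\<lambda>l. h\<^sup>2 * l\<^sup>2)"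
proof (intro exI conjI allI)
  \<comment> \<open>The remainder is found by solving the expansion for it, so the equation holds
    for every \<open>l\<close> and only the order bound has content.\<close>
  let ?r = "\<lambda>l. eta h l / h - (1 - h * l / 2)"
  show "eta h l = h * (1 - h * l / 2 + ?r l)" for l
    using assms by simp
  have "((\<lambda>l. \<bar>h * l\<bar>) \<longlongrightarrow> \<bar>h * 0\<bar>) (nhds 0)"
    by (intro tendsto_intros filterlim_ident)
  then have "\<forall>\<^sub>F l in nhds 0. \<bar>h * l\<bar> < 1"
    by (rule order_tendstoD) simp
  then have "\<forall>\<^sub>F l in nhds 0. norm (?r l) \<le> 1 * norm (h\<^sup>2 * l\<^sup>2)"
    by eventually_elim (use eta_second_order[OF assms] in auto)
  then show "?r \<in> O[nhds 0](\<lambda>l. h\<^sup>2 * l\<^sup>2)"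
    by (rule bigoI)
qed

lemma eta_expansion_uniform:
  "(\<lambda>(h, l). eta h l / h - (1 - h * l / 2)) \<in> O[product_to_0](\<lambda>(h, l). h\<^sup>2 * l\<^sup>2)"
proof -
  have "((\<lambda>(h, l). h * l) \<longlongrightarrow> 0) product_to_0"
    unfolding product_to_0_def by (rule filterlim_mono[OF filterlim_filtercomap order_refl inf_le1])
  then have lim: "((\<lambda>p. \<bar>case p of (h, l) \<Rightarrow> h * l\<bar>) \<longlongrightarrow> 0) product_to_0"
    by (rule tendsto_rabs_zero)
  have "\<forall>\<^sub>F p in product_to_0. \<bar>case p of (h, l) \<Rightarrow> h * l\<bar> < 1"
    by (rule order_tendstoD(2)[OF lim]) simp
  moreover have "\<forall>\<^sub>F p in product_to_0. 0 < fst p"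
    unfolding product_to_0_def eventually_inf_principal by (auto intro!: always_eventually)
  ultimately have "\<forall>\<^sub>F p in product_to_0. norm (case p of (h, l) \<Rightarrow> eta h l / h - (1 - h * l / 2))
      \<le> 1 * norm (case p of (h, l) \<Rightarrow> h\<^sup>2 * l\<^sup>2)"
    by eventually_elim (use eta_second_order in auto)
  then show ?thesis
    by (rule bigoI)
qed

lemma eta_neg:
  assumes "l < 0"
  shows "eta h l = (exp (h * \<bar>l\<bar>) - 1) / \<bar>l\<bar>"
  using assms by (simp add: eta_def field_simps)

text \<open>The quotient by the exponential tends to the nonzero limit
  \<open>1 / \<bar>l\<bar>\<close>, which gives the upper and the lower growth bound at
  once.\<close>

lemma eta_neg_bigtheta:
  assumes "l < 0"
  shows "(\<lambda>h. eta h l) \<in> \<Theta>[at_top](\<lambda>h. exp (h * \<bar>l\<bar>))"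
proof -
  have "LIM h at_top. \<bar>l\<bar> * h :> at_top"
    using assms by (intro filterlim_tendsto_pos_mult_at_top[OF tendsto_const _ filterlim_ident]) auto
  then have "((\<lambda>h. exp (- (\<bar>l\<bar> * h))) \<longlongrightarrow> 0) at_top"
    by (intro filterlim_compose[OF exp_at_bot] filterlim_compose[OF filterlim_uminus_at_bot_at_top])
  then have "((\<lambda>h. (1 - exp (- (\<bar>l\<bar> * h))) / \<bar>l\<bar>) \<longlongrightarrow> (1 - 0) / \<bar>l\<bar>) at_top"
    using assms by (intro tendsto_intros) auto
  moreover have "(1 - exp (- (\<bar>l\<bar> * h))) / \<bar>l\<bar> = eta h l / exp (h * \<bar>l\<bar>)" for h
    using assms by (simp add: eta_neg exp_minus field_simps)
  ultimately have "((\<lambda>h. eta h l / exp (h * \<bar>l\<bar>)) \<longlongrightarrow> 1 / \<bar>l\<bar>) at_top"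
    by simp
  then show ?thesis
    by (rule bigthetaI_tendsto[rotated]) (use assms in auto)
qed

section \<open>The doubling identity and its iteration\<close>

lemma eta_double: "eta (2 * h) l = eta h l * (2 - l * eta h l)"
proof (cases "l = 0")
  case False
  \<comment> \<open>With q = exp(-hl) the identity is 1 - q^2 = (1 - q)(1 + q), since
    \<open>2 - l * eta h l\<close> equals 1 + q.\<close>
  have "exp (- (2 * h) * l) = (exp (- h * l))\<^sup>2"
    by (simp flip: exp_double)
  then show ?thesis
    using False by (simp add: eta_def field_simps power2_eq_square)
qed (simp add: eta_def)

lemma horizon_matrix_double:
  assumes "orthogonal_matrix V" "G = conj_diag V lam" "0 \<le> h"
  shows "horizon_matrix G (2 * h) = doubling_step G (horizon_matrix G h)"
proof -
  let ?e = "\<chi> i. eta h (lam $ i)"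
  have "(\<chi> i. eta (2 * h) (lam $ i)) = ?e * (2 *\<^sub>R 1 - lam * ?e)"
    by (simp add: vec_eq_iff eta_double)
  then have "conj_diag V (\<chi> i. eta (2 * h) (lam $ i))
      = conj_diag V ?e ** (2 *\<^sub>R mat 1 - conj_diag V lam ** conj_diag V ?e)"
    by (simp only: conj_diag_mult[OF assms(1), symmetric] conj_diag_diff conj_diag_scaleR
        conj_diag_one[OF assms(1)])
  then show ?thesis
    using assms by (simp add: doubling_step_def horizon_matrix_conj_diag)
qed

text \<open>This expresses the cost of a geometric search: each candidate matrix comes from the
  previous one by a single \<open>doubling_step\<close>.\<close>

lemma horizon_matrix_doubling_iterate:
  assumes "orthogonal_matrix V" "G = conj_diag V lam" "0 \<le> h"
  shows "horizon_matrix G (2 ^ k * h) = (doubling_step G ^^ k) (horizon_matrix G h)"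
proof (induction k)
  case (Suc k)
  have "horizon_matrix G (2 ^ Suc k * h) = horizon_matrix G (2 * (2 ^ k * h))"
    by (simp add: mult.assoc)
  with Suc show ?case
    using horizon_matrix_double[OF assms(1,2), of "2 ^ k * h"] assms(3) by simp
qed simp

section \<open>Positive definite case: decrease of the quadratic model\<close>

lemma eta_bounds:
  assumes "0 < h" "0 < l"
  shows "0 < eta h l" "eta h l \<le> h" "l * eta h l < 1"
proof -
  have "1 - h * l \<le> exp (- h * l)"
    using exp_ge_add_one_self[of "- h * l"] by simp
  then show "eta h l \<le> h"
    using assms by (simp add: eta_def field_simps)
  show "0 < eta h l" "l * eta h l < 1"
    using assms by (simp_all add: eta_def)
qed

lemma pos_def_conj_diag_eigenvalue:
  assumes "orthogonal_matrix V" "pos_def (conj_diag V lam)"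
  shows "0 < lam $ i"
proof -
  \<comment> \<open>The quadratic form is tested on the \<open>i\<close>-th eigenvector, where its
    value is the eigenvalue itself.\<close>
  let ?v = "V *v axis i 1"
  have v: "transpose V *v ?v = axis i 1"
    using assms(1) by (simp add: matrix_vector_mul_assoc orthogonal_matrix_def)
  have "?v \<noteq> 0"
  proof
    assume "?v = 0"
    with v have "axis i (1::real) = 0"
      by simp
    then show False
      by (simp add: axis_eq_0_iff)
  qed
  then have "0 < ?v \<bullet> (conj_diag V lam *v ?v)"
    using assms(2) by (simp add: pos_def_def)
  also have "\<dots> = lam $ i"
    unfolding inner_conj_diag v by (simp add: axis_def mult_delta_left mult_delta_right)
  finally show ?thesis .
qed

text \<open>Positive definiteness enters through the eigenvalues. Below, \<open>c\<close> holds the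
  coordinates of \<open>g\<close> in the eigenbasis and \<open>e\<close> the eigenvalues of the
  horizon matrix.\<close>

locale posdef_horizon =
  fixes V :: "real^'n^'n" and lam :: "real^'n" and h :: real and g :: "real^'n"
  assumes V: "orthogonal_matrix V"
    and lam_pos: "\<And>i. 0 < lam $ i"
    and h_pos: "0 < h"
    and g_nz: "g \<noteq> 0"
begin

abbreviation G where "G \<equiv> conj_diag V lam"
abbreviation Hg where "Hg \<equiv> horizon_matrix G h *v g"
abbreviation c where "c \<equiv> transpose V *v g"
abbreviation e where "e \<equiv> \<chi> i. eta h (lam $ i)"

lemma horizon: "horizon_matrix G h = conj_diag V e"
  using horizon_matrix_conj_diag[OF V] h_pos by simp

lemmas e_bounds = eta_bounds[OF h_pos lam_pos]

text \<open>Parseval's identity, read off from the quadratic form of the identity matrix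
  \<open>conj_diag V 1\<close>.\<close>

lemma norm_coords: "(\<Sum>i\<in>UNIV. c $ i * c $ i) = (norm g)\<^sup>2"
proof -
  have "g \<bullet> (conj_diag V 1 *v g) = (\<Sum>i\<in>UNIV. c $ i * c $ i)"
    by (simp add: inner_conj_diag)
  then show ?thesis
    by (simp add: conj_diag_one[OF V] dot_square_norm)
qed

text \<open>All weights \<open>e $ i\<close> are positive, and \<open>g \<noteq> 0\<close> forces
  some coordinate to be nonzero.\<close>

lemma inner_Hg_pos: "0 < g \<bullet> Hg"
proof -
  have "0 < (\<Sum>i\<in>UNIV. c $ i * c $ i)"
    unfolding norm_coords using g_nz by simp
  then obtain j where "c $ j \<noteq> 0"
    by fastforce
  then have "0 < (\<Sum>i\<in>UNIV. e $ i * (c $ i * c $ i))"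
    using e_bounds(1) by (intro sum_pos2[of _ j]) (auto simp: less_imp_le zero_less_mult_iff linorder_neq_iff)
  then show ?thesis
    by (simp add: horizon inner_conj_diag)
qed

lemma norm_Hg_sqr: "(norm Hg)\<^sup>2 = (\<Sum>i\<in>UNIV. e $ i * e $ i * (c $ i * c $ i))"
  unfolding power2_norm_eq_inner horizon
  unfolding inner_conj_diag_conj_diag[OF V]
  unfolding inner_conj_diag by simp

text \<open>Only one of the two factors \<open>e $ i\<close> is replaced by \<open>h\<close>; the
  other one is kept to recover \<open>g \<bullet> Hg\<close>, so that the Taylor remainder can be
  compared with the model decrease.\<close>

lemma norm_Hg_sqr_le_inner: "(norm Hg)\<^sup>2 \<le> h * (g \<bullet> Hg)"
proof -
  have "(\<Sum>i\<in>UNIV. e $ i * e $ i * (c $ i * c $ i)) \<le> (\<Sum>i\<in>UNIV. h * (e $ i * (c $ i * c $ i)))"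
    by (subst mult.assoc, intro sum_mono mult_right_mono) (auto simp: less_imp_le e_bounds)
  then show ?thesis
    unfolding norm_Hg_sqr by (simp add: horizon inner_conj_diag sum_distrib_left)
qed

lemma norm_Hg_le: "norm Hg \<le> h * norm g"
proof -
  have "(\<Sum>i\<in>UNIV. e $ i * e $ i * (c $ i * c $ i)) \<le> (\<Sum>i\<in>UNIV. h * h * (c $ i * c $ i))"
    using h_pos by (intro sum_mono mult_right_mono mult_mono) (auto simp: less_imp_le e_bounds)
  also have "\<dots> = h * h * (norm g)\<^sup>2"
    by (simp only: sum_distrib_left[symmetric] norm_coords)
  finally have "(norm Hg)\<^sup>2 \<le> (h * norm g)\<^sup>2"
    unfolding norm_Hg_sqr by (simp add: power2_eq_square mult_ac)
  then show ?thesis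
    by (rule power2_le_imp_le) (use h_pos in simp)
qed

text \<open>The weight on the left is \<open>lam $ i * e $ i\<close> times the weight on the right,
  and that factor is below 1. Half of the first-order gain thus survives the curvature term.\<close>

lemma Hg_curvature_le: "Hg \<bullet> (G *v Hg) \<le> g \<bullet> Hg"
proof -
  have "Hg \<bullet> (G *v Hg) = g \<bullet> (conj_diag V (e * (lam * e)) *v g)"
    by (simp add: horizon matrix_vector_mul_assoc conj_diag_mult[OF V] inner_conj_diag_conj_diag[OF V])
  also have "\<dots> = (\<Sum>i\<in>UNIV. (lam $ i * e $ i) * (e $ i * (c $ i * c $ i)))"
    by (simp add: inner_conj_diag mult_ac)
  also have "\<dots> \<le> (\<Sum>i\<in>UNIV. 1 * (e $ i * (c $ i * c $ i)))"
    by (intro sum_mono mult_right_mono) (auto simp: less_imp_le e_bounds)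
  finally show ?thesis
    by (simp add: horizon inner_conj_diag)
qed

lemma quad_model_decrease:
  "(g \<bullet> Hg) / 2 \<le> quad_model f g G x x - quad_model f g G x (horizon_step G g h x)"
proof -
  have "quad_model f g G x x - quad_model f g G x (horizon_step G g h x)
      = g \<bullet> Hg - (Hg \<bullet> (G *v Hg)) / 2"
    by (simp add: quad_model_def horizon_step_def linear_neg[OF matrix_vector_mul_linear])
  then show ?thesis
    using Hg_curvature_le by simp
qed

lemma cubic_remainder_less_decrease:
  assumes "0 \<le> L" "L * h\<^sup>2 * norm g < 3"
  shows "L / 6 * norm Hg ^ 3 < (g \<bullet> Hg) / 2"
proof -
  \<comment> \<open>Two of the three factors are bounded through \<open>g \<bullet> Hg\<close> and
    the third by \<open>h * norm g\<close>. The remainder is then a multiple of the decrease, and 3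
    comes from comparing the constants 1/6 and 1/2.\<close>
  have "norm Hg ^ 3 = (norm Hg)\<^sup>2 * norm Hg"
    by (simp add: power2_eq_square power3_eq_cube)
  also have "\<dots> \<le> (h * (g \<bullet> Hg)) * (h * norm g)"
    using h_pos inner_Hg_pos by (intro mult_mono norm_Hg_sqr_le_inner norm_Hg_le) auto
  finally have "L / 6 * norm Hg ^ 3 \<le> L / 6 * ((h * (g \<bullet> Hg)) * (h * norm g))"
    using assms(1) by (intro mult_left_mono) auto
  also have "\<dots> = (L * h\<^sup>2 * norm g) * (g \<bullet> Hg) / 6"
    by (simp add: power2_eq_square)
  also have "\<dots> < 3 * (g \<bullet> Hg) / 6"
    using assms(2) inner_Hg_pos by (intro divide_strict_right_mono mult_strict_right_mono) auto
  finally show ?thesis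
    by simp
qed

end

section \<open>Taylor estimate and transfer of descent to the objective\<close>

lemma taylor2_upper_bound:
  fixes \<phi> :: "real \<Rightarrow> real"
  assumes \<phi>': "\<And>t. (\<phi> has_real_derivative \<phi>' t) (at t)"
    and \<phi>'': "\<And>t. (\<phi>' has_real_derivative \<phi>'' t) (at t)"
    and bound: "\<And>t. 0 \<le> t \<Longrightarrow> \<phi>'' t - \<phi>'' 0 \<le> M * t"
  shows "\<phi> 1 - (\<phi> 0 + \<phi>' 0 + \<phi>'' 0 / 2) \<le> M / 6"
proof -
  \<comment> \<open>\<open>?\<psi>\<close> is the function minus the nonconstant part of its
    quadratic Taylor polynomial and minus the cubic majorant. Its second derivative is nonpositive
    for \<open>t \<ge> 0\<close>, and two monotonicity arguments replace the integral form of the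
    remainder.\<close>
  let ?\<psi>' = "\<lambda>t. \<phi>' t - \<phi>' 0 - t * \<phi>'' 0 - M * t\<^sup>2 / 2"
  let ?\<psi> = "\<lambda>t. \<phi> t - t * \<phi>' 0 - t\<^sup>2 / 2 * \<phi>'' 0 - M * t ^ 3 / 6"
  have \<psi>'': "(?\<psi>' has_real_derivative (\<phi>'' t - \<phi>'' 0 - M * t)) (at t)" for t
    by (auto intro!: derivative_eq_intros \<phi>'')
  have "?\<psi>' t \<le> ?\<psi>' 0" if "0 \<le> t" for t
    using that
  proof (rule DERIV_nonpos_imp_nonincreasing)
    fix s :: real
    assume "0 \<le> s"
    then show "\<exists>y. (?\<psi>' has_real_derivative y) (at s) \<and> y \<le> 0"
      using \<psi>''[of s] bound[of s] by (intro exI conjI) auto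
  qed
  then have neg: "?\<psi>' t \<le> 0" if "0 \<le> t" for t
    using that by simp
  have \<psi>': "(?\<psi> has_real_derivative ?\<psi>' t) (at t)" for t
    by (auto intro!: derivative_eq_intros \<phi>' simp: power2_eq_square)
  have "?\<psi> 1 \<le> ?\<psi> 0"
    using zero_le_one by (rule DERIV_nonpos_imp_nonincreasing) (use \<psi>' neg in blast)
  then show ?thesis
    by simp
qed

text \<open>On the segment from \<open>x\<close> to \<open>y\<close> the problem is one-dimensional.
  The constant \<open>L * norm d ^ 3\<close> collects one factor from the displacement
  \<open>t *\<^sub>R d\<close> and two from the quadratic form in \<open>d\<close>.\<close>

lemma lipschitz_hessian_quad_model_error:
  assumes gh: "has_gradient_hessian f gf Hf" and lip: "lipschitz_hessian L Hf"
  shows "\<bar>f y - quad_model f (gf x) (Hf x) x y\<bar> \<le> L / 6 * norm (y - x) ^ 3"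
proof -
  define d where "d = y - x"
  let ?p = "\<lambda>t. x + t *\<^sub>R d"
  define \<phi> where "\<phi> = (\<lambda>t. f (?p t))"
  define \<phi>' where "\<phi>' = (\<lambda>t. gf (?p t) \<bullet> d)"
  define \<phi>'' where "\<phi>'' = (\<lambda>t. d \<bullet> (Hf (?p t) *v d))"
  have p: "(?p has_derivative (\<lambda>s. s *\<^sub>R d)) (at t)" for t
    by (auto intro!: derivative_eq_intros)
  have \<phi>': "(\<phi> has_real_derivative \<phi>' t) (at t)" for t
  proof -
    have "(f has_derivative (\<lambda>v. v \<bullet> gf (?p t))) (at (?p t))"
      using gh by (simp add: has_gradient_hessian_def gderiv_def)
    from has_derivative_compose[OF p this] show ?thesis
      unfolding \<phi>_def \<phi>'_def has_field_derivative_def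
      by (rule has_derivative_eq_rhs) (simp add: fun_eq_iff inner_commute)
  qed
  have \<phi>'': "(\<phi>' has_real_derivative \<phi>'' t) (at t)" for t
  proof -
    have "(gf has_derivative (\<lambda>v. Hf (?p t) *v v)) (at (?p t))"
      using gh by (simp add: has_gradient_hessian_def)
    from has_derivative_inner_left[OF has_derivative_compose[OF p this], of d] show ?thesis
      unfolding \<phi>'_def \<phi>''_def has_field_derivative_def
      by (rule has_derivative_eq_rhs)
         (simp add: fun_eq_iff inner_commute matrix_vector_mult_scaleR)
  qed
  have bound: "\<bar>\<phi>'' t - \<phi>'' 0\<bar> \<le> L * norm d ^ 3 * t" if "0 \<le> t" for t
  proof -
    let ?A = "Hf (?p t) - Hf x"
    have "\<bar>\<phi>'' t - \<phi>'' 0\<bar> = \<bar>d \<bullet> (?A *v d)\<bar>"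
      by (simp add: \<phi>''_def matrix_vector_mult_diff_rdistrib inner_diff_right)
    also have "\<dots> \<le> norm d * norm (?A *v d)"
      by (rule Cauchy_Schwarz_ineq2)
    also have "\<dots> \<le> norm d * (spectral_norm ?A * norm d)"
      unfolding spectral_norm_def by (intro mult_left_mono onorm matrix_vector_mul_bounded_linear) auto
    also have "\<dots> \<le> norm d * (L * norm (?p t - x) * norm d)"
      using lip[unfolded lipschitz_hessian_def, rule_format, of "?p t" x]
      by (intro mult_left_mono mult_right_mono) auto
    finally show ?thesis
      using that by (simp add: power3_eq_cube mult_ac)
  qed
  have "\<phi> 1 - (\<phi> 0 + \<phi>' 0 + \<phi>'' 0 / 2) \<le> (L * norm d ^ 3) / 6"
    using bound by (intro taylor2_upper_bound \<phi>' \<phi>'') (auto simp: abs_le_iff)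
  \<comment> \<open>The lower bound is the one-sided Taylor estimate applied to the negated
    function.\<close>
  moreover have "- \<phi> 1 - (- \<phi> 0 + - \<phi>' 0 + - \<phi>'' 0 / 2) \<le> (L * norm d ^ 3) / 6"
    using bound by (intro taylor2_upper_bound DERIV_minus \<phi>' \<phi>'') (auto simp: abs_le_iff)
  ultimately have "\<bar>\<phi> 1 - (\<phi> 0 + \<phi>' 0 + \<phi>'' 0 / 2)\<bar> \<le> L / 6 * norm d ^ 3"
    unfolding abs_le_iff by argo
  then show ?thesis
    by (simp add: \<phi>_def \<phi>'_def \<phi>''_def d_def quad_model_def)
qed

text \<open>In the second claim \<open>h0\<close> is chosen before \<open>f\<close> and
  \<open>x\<close>, so one threshold serves every objective with the given gradient, Hessian and
  Lipschitz constant.\<close>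

lemma posdef_horizon_step_descent:
  assumes "orthogonal_matrix V" "G = conj_diag V lam" "pos_def G" "g \<noteq> 0"
  shows "0 < h \<Longrightarrow> quad_model f g G x (horizon_step G g h x) < quad_model f g G x x"
    and "0 \<le> L \<Longrightarrow> \<exists>h0>0. \<forall>f gf Hf x.
      has_gradient_hessian f gf Hf \<and> lipschitz_hessian L Hf \<and> gf x = g \<and> Hf x = G \<longrightarrow>
      (\<forall>h. 0 < h \<and> h \<le> h0 \<longrightarrow> f (horizon_step G g h x) < f x)"
proof -
  have loc: "posdef_horizon V lam h g" if "0 < h" for h
    using assms that pos_def_conj_diag_eigenvalue[OF assms(1)] by unfold_locales auto
  show "quad_model f g G x (horizon_step G g h x) < quad_model f g G x x" if "0 < h" for f x h
    using posdef_horizon.quad_model_decrease[OF loc[OF that], of f x]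
      posdef_horizon.inner_Hg_pos[OF loc[OF that]]
    by (simp add: assms(2))
  show "\<exists>h0>0. \<forall>f gf Hf x.
      has_gradient_hessian f gf Hf \<and> lipschitz_hessian L Hf \<and> gf x = g \<and> Hf x = G \<longrightarrow>
      (\<forall>h. 0 < h \<and> h \<le> h0 \<longrightarrow> f (horizon_step G g h x) < f x)" if L: "0 \<le> L"
  \<comment> \<open>With a = L * norm g, the bound h(1 + a) \<le> 1 yields both h \<le> 1 and ha
    \<le> 1, hence h^2 a \<le> 1 < 3. The summand 1 keeps the denominator positive when
    \<open>L = 0\<close> and avoids a square root.\<close>
  proof (intro exI[of _ "1 / (1 + L * norm g)"] conjI allI impI; (elim conjE)?)
    have nonneg: "0 \<le> L * norm g"
      using L by simp
    then show "0 < 1 / (1 + L * norm g)"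
      by simp
    fix f gf Hf x h
    assume f: "has_gradient_hessian f gf Hf" "lipschitz_hessian L Hf" "gf x = g" "Hf x = G"
      and h: "0 < h" "h \<le> 1 / (1 + L * norm g)"
    have "h + h * (L * norm g) \<le> 1"
      using h(2) nonneg by (simp add: field_simps)
    moreover have "0 \<le> h * (L * norm g)"
      using h(1) nonneg by simp
    ultimately have "h \<le> 1" "h * (L * norm g) \<le> 1"
      using h(1) by linarith+
    then have "h * (h * (L * norm g)) \<le> 1 * 1"
      using h(1) nonneg by (intro mult_mono) auto
    then have "L * h\<^sup>2 * norm g < 3"
      by (simp add: power2_eq_square mult_ac)
    note R = posdef_horizon.cubic_remainder_less_decrease[OF loc[OF h(1)] L this]
    show "f (horizon_step G g h x) < f x"
    proof -
      let ?xp = "horizon_step G g h x"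
      have "\<bar>f ?xp - quad_model f g G x ?xp\<bar> \<le> L / 6 * norm (horizon_matrix G h *v g) ^ 3"
        using lipschitz_hessian_quad_model_error[OF f(1,2), of ?xp x]
        by (simp add: f(3,4) horizon_step_def)
      moreover have "quad_model f g G x x = f x"
        by (simp add: quad_model_def)
      ultimately show ?thesis
        using R posdef_horizon.quad_model_decrease[OF loc[OF h(1)], of f x]
        unfolding assms(2)[symmetric] by linarith
    qed
  qed
qed

section \<open>Assembly of the spectral, scalar, doubling and descent claims\<close>

theorem proposition5p2:
  fixes G V :: "real^'n^'n" and lam :: "real^'n"
  assumes "transpose G = G"
    and "orthogonal_matrix V"
    and "G = V ** diag_matrix lam ** transpose V"
  shows
    "(\<forall>h>0. horizon_matrix G h = V ** diag_matrix (\<chi> i. eta h (lam $ i)) ** transpose V)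
   \<and>
     ((\<forall>l>0. ((\<lambda>h. eta h l) \<longlongrightarrow> 1 / l) at_top) \<and>
      (\<lambda>(h, l). eta h l) \<sim>[product_at_top] (\<lambda>(h, l). 1 / l))
   \<and>
     ((\<forall>h>0. \<exists>r. (\<forall>l. eta h l = h * (1 - h * l / 2 + r l)) \<and>
               r \<in> O[nhds 0](\<lambda>l. h\<^sup>2 * l\<^sup>2)) \<and>
      (\<lambda>(h, l). eta h l / h - (1 - h * l / 2)) \<in> O[product_to_0](\<lambda>(h, l). h\<^sup>2 * l\<^sup>2))
   \<and>
     (\<forall>l<0. (\<forall>h>0. eta h l = (exp (h * \<bar>l\<bar>) - 1) / \<bar>l\<bar>) \<and>
             (\<lambda>h. eta h l) \<in> \<Theta>[at_top](\<lambda>h. exp (h * \<bar>l\<bar>)))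
   \<and>
     (\<forall>h>0. horizon_matrix G (2 * h) =
              horizon_matrix G h ** (2 *\<^sub>R mat 1 - G ** horizon_matrix G h) \<and>
            (\<forall>k. horizon_matrix G (2 ^ k * h) = (doubling_step G ^^ k) (horizon_matrix G h)))
   \<and>
     (pos_def G \<longrightarrow>
       (\<forall>g. g \<noteq> 0 \<longrightarrow>
         (\<forall>f x h. 0 < h \<and> h \<le> 0.1 / spectral_norm G \<longrightarrow>
            quad_model f g G x (horizon_step G g h x) < quad_model f g G x x) \<and>
         (\<forall>L\<ge>0. \<exists>h0>0. \<forall>f gf Hf x.
            has_gradient_hessian f gf Hf \<and> lipschitz_hessian L Hf \<and> gf x = g \<and> Hf x = G \<longrightarrow>
            (\<forall>h. 0 < h \<and> h \<le> 0.1 / spectral_norm G \<longrightarrow>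
               (let xp = horizon_step G g h x;
                    q = quad_model f g G x;
                    R = L / 6 * norm (xp - x) ^ 3
                in \<bar>f xp - q xp\<bar> \<le> R \<and>
                   (R < q x - q xp \<longrightarrow> f xp < f x) \<and>
                   (h \<le> h0 \<longrightarrow> f xp < f x))))))"
proof -
  note V = assms(2)
  have G: "G = conj_diag V lam"
    using assms(3) by (simp add: conj_diag_def)
  have spectral: "\<forall>h>0. horizon_matrix G h = V ** diag_matrix (\<chi> i. eta h (lam $ i)) ** transpose V"
    using horizon_matrix_conj_diag[OF V] by (simp add: G conj_diag_def)
  have doubling: "\<forall>h>0. horizon_matrix G (2 * h) =
              horizon_matrix G h ** (2 *\<^sub>R mat 1 - G ** horizon_matrix G h) \<and>
            (\<forall>k. horizon_matrix G (2 ^ k * h) = (doubling_step G ^^ k) (horizon_matrix G h))"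
    using horizon_matrix_double[OF V G] horizon_matrix_doubling_iterate[OF V G]
    by (simp add: doubling_step_def)
  \<comment> \<open>Transfer is stated in three layers: the model error is at most \<open>R\<close>,
    descent follows whenever the model decrease exceeds \<open>R\<close>, and horizons up to
    \<open>h0\<close> guarantee descent outright.\<close>
  have transfer: "\<exists>h0>0. \<forall>f gf Hf x.
            has_gradient_hessian f gf Hf \<and> lipschitz_hessian L Hf \<and> gf x = g \<and> Hf x = G \<longrightarrow>
            (\<forall>h. 0 < h \<and> h \<le> 0.1 / spectral_norm G \<longrightarrow>
               (let xp = horizon_step G g h x;
                    q = quad_model f g G x;
                    R = L / 6 * norm (xp - x) ^ 3
                in \<bar>f xp - q xp\<bar> \<le> R \<and>
                   (R < q x - q xp \<longrightarrow> f xp < f x) \<and>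
                   (h \<le> h0 \<longrightarrow> f xp < f x)))"
    if pd: "pos_def G" and g: "g \<noteq> 0" and L: "0 \<le> L" for g L
  proof -
    obtain h0 where h0: "0 < h0" and descent: "\<forall>f gf Hf x.
        has_gradient_hessian f gf Hf \<and> lipschitz_hessian L Hf \<and> gf x = g \<and> Hf x = G \<longrightarrow>
        (\<forall>h. 0 < h \<and> h \<le> h0 \<longrightarrow> f (horizon_step G g h x) < f x)"
      using posdef_horizon_step_descent(2)[OF V G pd g L] by (elim exE conjE)
    show ?thesis
      unfolding Let_def
    proof (intro exI[of _ h0] conjI allI impI h0; (elim conjE)?)
      fix f gf Hf x and h :: real
      assume f: "has_gradient_hessian f gf Hf" "lipschitz_hessian L Hf" "gf x = g" "Hf x = G"
        and h: "0 < h"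
      let ?xp = "horizon_step G g h x"
      show error: "\<bar>f ?xp - quad_model f g G x ?xp\<bar> \<le> L / 6 * norm (?xp - x) ^ 3"
        using lipschitz_hessian_quad_model_error[OF f(1,2), of ?xp x] f(3,4) by simp
      show "f ?xp < f x"
        if "L / 6 * norm (?xp - x) ^ 3 < quad_model f g G x x - quad_model f g G x ?xp"
      proof -
        \<comment> \<open>The model agrees with the objective at the base point, so an error smaller
          than the decrease cannot cancel it.\<close>
        have "quad_model f g G x x = f x"
          by (simp add: quad_model_def)
        with error that show ?thesis
          by linarith
      qed
      show "f ?xp < f x" if "h \<le> h0"
        by (intro descent[rule_format, of f gf Hf] conjI f h that)
    qed
  qed
  show ?thesis
  proof (intro conjI impI spectral doubling eta_asymp_equiv_inverse eta_expansion_uniform)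
    show "\<forall>l>0. ((\<lambda>h. eta h l) \<longlongrightarrow> 1 / l) at_top"
      using eta_tendsto_inverse by blast
    show "\<forall>h>0. \<exists>r. (\<forall>l. eta h l = h * (1 - h * l / 2 + r l)) \<and> r \<in> O[nhds 0](\<lambda>l. h\<^sup>2 * l\<^sup>2)"
      using eta_expansion_fixed_horizon by blast
    show "\<forall>l<0. (\<forall>h>0. eta h l = (exp (h * \<bar>l\<bar>) - 1) / \<bar>l\<bar>) \<and>
             (\<lambda>h. eta h l) \<in> \<Theta>[at_top](\<lambda>h. exp (h * \<bar>l\<bar>))"
      using eta_neg eta_neg_bigtheta by blast
  qed (intro allI impI conjI transfer posdef_horizon_step_descent(1)[OF V G]; simp)
qed

end
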